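(* Let $D$ be a connected simple digraph. The critical group of $D$ has exactly one invariant factor equal to $1$ if and only if $D$ is isomorphic to a digraph $\Lambda_{n_1,n_2,n_3}$, where the integers $n_1,n_2,n_3$ satisfy one of the following conditions: (1) $n_1,n_2,n_3\geq1$; (2) $n_1=n_2=1$, $n_3=0$; (3) $n_1=n_3=1$, $n_2=0$; (4) $n_2=n_3=1$, $n_1=0$; (5) $n_1\geq0$, $n_2\geq2$, $n_3\geq0$; (6) $n_1=0$, $n_2=1$, $n_3\geq2$; (7) $n_1=1$, $n_2=0$, $n_3\geq2$; (8) $n_1\geq2$, $n_2=0$, $n_3\geq2$.
   Context: Digraphs are finite and have no loops. A digraph is connected if its underlying undirected graph is connected. A digraph is simple if for each ordered pair $(u,v)$ of distinct vertices there is at most one arc from $u$ to $v$ (both arcs $u\to v$ and $v\to u$ may be present). The Laplacian matrix $L(D)$ of a digraph $D$ has rows and columns indexed by the vertices, with $L(D)_{uu}=\deg^+(u)$ (the out-degree of $u$) and $L(D)_{uv}=-m_{uv}$ for $u\neq v$, where $m_{uv}$ is the number of arcs from $u$ to $v$. The critical group $K(D)$ is the torsion part of the cokernel of $L(D)$. Its invariant factors are those of $L(D)$, i.e. the diagonal entries of the Smith normal form of $L(D)$ over $\mathbb{Z}$ (so $f_i=\Delta_i(L(D))/\Delta_{i-1}(L(D))$ when $\Delta_{i-1}(L(D))\neq0$, where $\Delta_i$ is the greatest common divisor of the $i$-minors and $\Delta_0=1$). "Exactly one invariant factor equal to $1$" means that exactly one of these diagonal entries equals $1$. For integers $n_1,n_2,n_3\geq0$,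 $\Lambda_{n_1,n_2,n_3}$ is the simple digraph whose vertex set is partitioned into three sets $T,K,T'$ of sizes $n_1,n_2,n_3$ respectively, and whose arcs are exactly: both arcs between every pair of distinct vertices of $K$; every arc from a vertex of $T$ to a vertex of $K$; every arc from a vertex of $T$ to a vertex of $T'$; and every arc from a vertex of $K$ to a vertex of $T'$. (There are no arcs inside $T$ or inside $T'$.) *)

theory Defs
  imports
    "Graph_Theory.Graph_Theory"
    "Jordan_Normal_Form.Matrix"
begin

section \<open>Smith normal form over the integers\<close>

definition is_smith_normal_form :: "int mat \<Rightarrow> int mat \<Rightarrow> bool" where
  "is_smith_normal_form A S \<longleftrightarrow>
     (\<exists>P Q. P \<in> carrier_mat (dim_row A) (dim_row A) \<and> invertible_mat P \<and>
            Q \<in> carrier_mat (dim_col A) (dim_col A) \<and> invertible_mat Q \<and>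
            S = P * A * Q) \<and>
     diagonal_mat S \<and>
     (\<forall>i < min (dim_row A) (dim_col A). 0 \<le> S $$ (i, i)) \<and>
     (\<forall>i. Suc i < min (dim_row A) (dim_col A) \<longrightarrow> S $$ (i, i) dvd S $$ (Suc i, Suc i))"

text \<open>Every integer matrix has exactly one Smith normal form, so the choice below does not
  matter. The list has full length \<open>min m n\<close>; entries \<open>1\<close> and \<open>0\<close> are kept.\<close>

definition smith_normal_form :: "int mat \<Rightarrow> int mat" where
  "smith_normal_form A = (SOME S. is_smith_normal_form A S)"

definition invariant_factors_mat :: "int mat \<Rightarrow> int list" where
  "invariant_factors_mat A =
     map (\<lambda>i. smith_normal_form A $$ (i, i)) [0..<min (dim_row A) (dim_col A)]"


section \<open>Laplacian matrix and invariant factors of the critical group\<close>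

definition arc_multiplicity :: "('v, 'e) pre_digraph \<Rightarrow> 'v \<Rightarrow> 'v \<Rightarrow> nat" where
  "arc_multiplicity G u v = card {e \<in> arcs G. tail G e = u \<and> head G e = v}"

definition laplacian :: "('v, 'e) pre_digraph \<Rightarrow> 'v \<Rightarrow> 'v \<Rightarrow> int" where
  "laplacian G u v =
     (if u = v then int (out_degree G u) else - int (arc_multiplicity G u v))"

text \<open>Matrices are indexed by numbers, so the vertices have to be listed in some order. Changing
  the order permutes rows and columns simultaneously, which leaves the Smith normal form
  unchanged; hence an arbitrary order is used.\<close>

definition vertex_order :: "('v, 'e) pre_digraph \<Rightarrow> 'v list" where
  "vertex_order G = (SOME vs. distinct vs \<and> set vs = verts G)"

definition laplacian_mat :: "('v, 'e) pre_digraph \<Rightarrow> int mat" where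
  "laplacian_mat G =
     mat (card (verts G)) (card (verts G))
       (\<lambda>(i, j). laplacian G (vertex_order G ! i) (vertex_order G ! j))"

text \<open>The critical group is the torsion part of the cokernel of the Laplacian. Its invariant
  factors are by definition those of the Laplacian matrix, including the factors \<open>1\<close>, which are
  not determined by the isomorphism type of the group.\<close>

definition critical_group_invariant_factors :: "('v, 'e) pre_digraph \<Rightarrow> int list" where
  "critical_group_invariant_factors G = invariant_factors_mat (laplacian_mat G)"


section \<open>The digraphs \<open>\<Lambda>\<close>\<close>

datatype lambda_vertex = VT nat | VK nat | VT' nat

text \<open>An arc is the pair of its tail and its head.\<close>

definition Lambda ::
  "nat \<Rightarrow> nat \<Rightarrow> nat \<Rightarrow> (lambda_vertex, lambda_vertex \<times> lambda_vertex) pre_digraph" where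
  "Lambda n1 n2 n3 =
     (let T = VT ` {..<n1}; K = VK ` {..<n2}; T' = VT' ` {..<n3} in
      \<lparr> verts = T \<union> K \<union> T',
        arcs = {(u, v). u \<in> K \<and> v \<in> K \<and> u \<noteq> v} \<union> T \<times> K \<union> T \<times> T' \<union> K \<times> T',
        tail = fst,
        head = snd \<rparr>)"

end

theory Submission
  imports
    Defs
    "Jordan_Normal_Form.Column_Operations"
    "HOL-Number_Theory.Cong"
begin

text \<open>
  In terms of determinantal divisors, exactly one invariant factor is one iff the entries of the
  Laplacian have no common divisor but the 2-minors have one, possibly zero. The proof replaces
  the second condition by an equivalent one that is easier to transport: modulo some non-unit \<open>k\<close>
  the Laplacian is the product of a column and a row
  (\<open>exactly_one_unit_invariant_factor_iff\<close>). This form is visibly stable under multiplication by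
  unimodular matrices, so it passes between a matrix and its Smith normal form. The existence of
  that form (\<open>smith_normal_form_exists\<close>) comes from choosing a nonzero entry of least absolute
  value among all equivalent matrices.

  For the forward direction, no 2-minor of the Laplacian may be a unit. A vertex \<open>x\<close> that
  is an out-neighbour of one non-sink but not of another non-sink, different from \<open>x\<close>, would give
  a triangular 2-minor with diagonal \<open>-1, -1\<close> (\<open>same_out_neighbours\<close>). Hence all non-sinks point to
  the same vertices, apart from themselves, and with connectedness this is precisely the arc
  structure of \<open>\<Lambda>\<close>: \<open>T\<close> are the sources, \<open>T'\<close> the sinks and \<open>K\<close> the rest.

  It remains to decide which of the digraphs \<open>\<Lambda>\<close> qualify. With \<open>m = n\<^sub>2 + n\<^sub>3\<close>, the
  row of each non-sink is congruent modulo \<open>m\<close> to one fixed row, so \<open>k = m\<close> works as soon as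
  \<open>m \<noteq> 1\<close>. For \<open>m = 1\<close> the digraph is an in-star, possibly without leaves, and \<open>T\<close> indexes an
  identity submatrix; this is harmless only if \<open>T\<close> has at most one vertex. Finally an arc must
  exist, for otherwise the Laplacian is zero
  (\<open>exactly_one_unit_iff_if_Lambda_partition\<close>, \<open>Lambda_partition_has_arc_iff\<close>).
\<close>

section \<open>Unimodular equivalence of integer matrices\<close>

definition unimodular :: "nat \<Rightarrow> int mat \<Rightarrow> bool" where
  "unimodular n P \<longleftrightarrow> P \<in> carrier_mat n n \<and>
     (\<exists>P' \<in> carrier_mat n n. P * P' = 1\<^sub>m n \<and> P' * P = 1\<^sub>m n)"

lemma unimodularI:
  assumes "P \<in> carrier_mat n n" "P' \<in> carrier_mat n n" "P * P' = 1\<^sub>m n" "P' * P = 1\<^sub>m n"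
  shows "unimodular n P"
  using assms unfolding unimodular_def by blast

lemma unimodular_iff_invertible_mat:
  "unimodular n P \<longleftrightarrow> P \<in> carrier_mat n n \<and> invertible_mat P"
proof
  assume "unimodular n P"
  then show "P \<in> carrier_mat n n \<and> invertible_mat P"
    unfolding unimodular_def invertible_mat_def inverts_mat_def
    by (metis carrier_matD(1,2) square_mat.simps)
next
  assume P: "P \<in> carrier_mat n n \<and> invertible_mat P"
  then obtain B where B: "P * B = 1\<^sub>m n" "B * P = 1\<^sub>m (dim_row B)"
    unfolding invertible_mat_def inverts_mat_def by auto
  have "dim_col B = n"
    using arg_cong[OF B(1), of dim_col] by simp
  moreover have "dim_row B = n"
    using arg_cong[OF B(2), of dim_col] P by auto
  ultimately show "unimodular n P"
    using P B by (intro unimodularI[of _ _ B]) auto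
qed

lemma unimodular_one: "unimodular n (1\<^sub>m n)"
  by (rule unimodularI[of _ _ "1\<^sub>m n"]) auto

lemma unimodular_mult:
  assumes "unimodular n P" "unimodular n Q"
  shows "unimodular n (P * Q)"
proof -
  obtain P' where P: "P \<in> carrier_mat n n" "P' \<in> carrier_mat n n" "P * P' = 1\<^sub>m n" "P' * P = 1\<^sub>m n"
    using assms(1) unfolding unimodular_def by blast
  obtain Q' where Q: "Q \<in> carrier_mat n n" "Q' \<in> carrier_mat n n" "Q * Q' = 1\<^sub>m n" "Q' * Q = 1\<^sub>m n"
    using assms(2) unfolding unimodular_def by blast
  have "P * Q * (Q' * P') = P * (Q * Q') * P'"
    using P(1,2) Q(1,2) by (simp add: assoc_mult_mat[of _ n n _ n _ n])
  moreover have "Q' * P' * (P * Q) = Q' * (P' * P) * Q"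
    using P(1,2) Q(1,2) by (simp add: assoc_mult_mat[of _ n n _ n _ n])
  ultimately show ?thesis
    using P Q by (intro unimodularI[of _ _ "Q' * P'"]) auto
qed

text \<open>Smith normal form is a representative of the orbit of a matrix under this relation. Both
properties of a matrix that matter later, its common divisors and its rank modulo an integer,
are constant on the orbits.\<close>

definition mat_equiv :: "int mat \<Rightarrow> int mat \<Rightarrow> bool" where
  "mat_equiv A B \<longleftrightarrow>
     (\<exists>P Q. unimodular (dim_row A) P \<and> unimodular (dim_col A) Q \<and> B = P * A * Q)"

lemma mat_equivI:
  assumes "A \<in> carrier_mat m n" "unimodular m P" "unimodular n Q" "B = P * A * Q"
  shows "mat_equiv A B"
  using assms unfolding mat_equiv_def by auto

lemma mat_equivE:
  assumes "mat_equiv A B" "A \<in> carrier_mat m n"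
  obtains P Q where "unimodular m P" "unimodular n Q" "B = P * A * Q"
  using assms unfolding mat_equiv_def by auto

lemma mat_equiv_carrier:
  assumes "mat_equiv A B" "A \<in> carrier_mat m n"
  shows "B \<in> carrier_mat m n"
  using assms unfolding mat_equiv_def unimodular_def by auto

lemma mat_equiv_left:
  assumes "A \<in> carrier_mat m n" "unimodular m P"
  shows "mat_equiv A (P * A)"
  using assms by (intro mat_equivI[OF _ _ unimodular_one]) (auto simp: unimodular_def)

lemma mat_equiv_right:
  assumes "A \<in> carrier_mat m n" "unimodular n Q"
  shows "mat_equiv A (A * Q)"
  using assms by (intro mat_equivI[OF _ unimodular_one]) auto

lemma mat_equiv_refl: "mat_equiv A A"
  by (rule mat_equivI[OF _ unimodular_one unimodular_one, of _ "dim_row A" "dim_col A"]) auto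

lemma mat_equiv_trans [trans]:
  assumes "mat_equiv A B" "mat_equiv B C"
  shows "mat_equiv A C"
proof -
  define m where "m = dim_row A"
  define n where "n = dim_col A"
  have A: "A \<in> carrier_mat m n" by (simp add: m_def n_def)
  obtain P Q where PQ: "unimodular m P" "unimodular n Q" "B = P * A * Q"
    using mat_equivE[OF assms(1) A] .
  obtain P' Q' where PQ': "unimodular m P'" "unimodular n Q'" "C = P' * B * Q'"
    using mat_equivE[OF assms(2) mat_equiv_carrier[OF assms(1) A]] .
  have c: "P \<in> carrier_mat m m" "Q \<in> carrier_mat n n" "P' \<in> carrier_mat m m" "Q' \<in> carrier_mat n n"
    using PQ PQ' unfolding unimodular_def by auto
  have "C = P' * (P * A) * Q * Q'"
    using A c unfolding PQ'(3) PQ(3) by (subst assoc_mult_mat[of P' m m "P * A" n Q n]) auto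
  also have "\<dots> = P' * P * A * Q * Q'"
    using A c by (subst assoc_mult_mat[of P' m m P m A n]) auto
  also have "\<dots> = P' * P * A * (Q * Q')"
    using A c by (intro assoc_mult_mat[of _ m n Q n Q' n]) auto
  finally have "C = P' * P * A * (Q * Q')" .
  then show ?thesis
    using mat_equivI[OF A unimodular_mult[OF PQ'(1) PQ(1)] unimodular_mult[OF PQ(2) PQ'(2)]] by simp
qed

lemma mat_equiv_sym:
  assumes "mat_equiv A B"
  shows "mat_equiv B A"
proof -
  define m where "m = dim_row A"
  define n where "n = dim_col A"
  have A: "A \<in> carrier_mat m n" by (simp add: m_def n_def)
  obtain P Q where PQ: "unimodular m P" "unimodular n Q" "B = P * A * Q"
    using mat_equivE[OF assms A] .
  obtain P' where P: "P \<in> carrier_mat m m" "P' \<in> carrier_mat m m" "P * P' = 1\<^sub>m m" "P' * P = 1\<^sub>m m"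
    using PQ(1) unfolding unimodular_def by blast
  obtain Q' where Q: "Q \<in> carrier_mat n n" "Q' \<in> carrier_mat n n" "Q * Q' = 1\<^sub>m n" "Q' * Q = 1\<^sub>m n"
    using PQ(2) unfolding unimodular_def by blast
  have "P' * B * Q' = P' * (P * A) * Q * Q'"
    using A P(1,2) Q(1,2) unfolding PQ(3) by (subst assoc_mult_mat[of P' m m "P * A" n Q n]) auto
  also have "\<dots> = P' * P * A * Q * Q'"
    using A P(1,2) by (subst assoc_mult_mat[of P' m m P m A n]) auto
  also have "\<dots> = P' * P * A * (Q * Q')"
    using A P(1,2) Q(1,2) by (intro assoc_mult_mat[of _ m n Q n Q' n]) auto
  also have "\<dots> = A" using A P Q by simp
  finally have "A = P' * B * Q'" ..
  then show ?thesis
    using mat_equiv_carrier[OF assms A] P Q by (intro mat_equivI[of B m n P' Q'] unimodularI[of P' m P] unimodularI[of Q' n Q])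
qed

lemma unimodular_addrow_mat: "k < n \<Longrightarrow> l < n \<Longrightarrow> k \<noteq> l \<Longrightarrow> unimodular n (addrow_mat n a k l)"
  using addrow_mat_inv[of k n l a] addrow_mat_inv[of k n l "- a"]
  by (intro unimodularI[of _ _ "addrow_mat n (- a) k l"]) auto

lemma unimodular_swaprows_mat: "k < n \<Longrightarrow> l < n \<Longrightarrow> unimodular n (swaprows_mat n k l)"
  using swaprows_mat_inv[of k n l]
  by (intro unimodularI[of _ _ "swaprows_mat n k l"]) auto

lemma mat_equiv_addrow:
  assumes "A \<in> carrier_mat m n" "k < m" "l < m" "k \<noteq> l"
  shows "mat_equiv A (addrow a k l A)"
  using mat_equiv_left[OF assms(1) unimodular_addrow_mat[OF assms(2-4)]] addrow_mat[OF assms(1,3)]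
  by simp

lemma mat_equiv_addcol:
  assumes "A \<in> carrier_mat m n" "k < n" "l < n" "k \<noteq> l"
  shows "mat_equiv A (addcol a k l A)"
  using mat_equiv_right[OF assms(1) unimodular_addrow_mat[of l n k a]] addcol_mat[OF assms(1,3)] assms
  by (simp)

lemma mat_equiv_swaprows:
  assumes "A \<in> carrier_mat m n" "k < m" "l < m"
  shows "mat_equiv A (swaprows k l A)"
  using mat_equiv_left[OF assms(1) unimodular_swaprows_mat[OF assms(2,3)]] swaprows_mat[OF assms]
  by simp

lemma mat_equiv_swapcols:
  assumes "A \<in> carrier_mat m n" "k < n" "l < n"
  shows "mat_equiv A (swapcols k l A)"
  using mat_equiv_right[OF assms(1) unimodular_swaprows_mat[OF assms(2,3)]] swapcols_mat[OF assms]
  by simp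

text \<open>The block-diagonal matrix with blocks \<open>d\<close> and \<open>D\<close>. Indexing it by \<open>0\<close> and \<open>Suc\<close> makes
entries accessible by case distinction, in step with the induction on the number of rows.\<close>

definition border_block :: "int \<Rightarrow> int mat \<Rightarrow> int mat" where
  "border_block d D = mat (Suc (dim_row D)) (Suc (dim_col D))
     (\<lambda>(i, j). case (i, j) of (0, 0) \<Rightarrow> d | (Suc k, Suc l) \<Rightarrow> D $$ (k, l) | _ \<Rightarrow> 0)"

lemma border_block_carrier [simp]:
  "D \<in> carrier_mat m n \<Longrightarrow> border_block d D \<in> carrier_mat (Suc m) (Suc n)"
  by (auto simp: border_block_def)

lemma border_block_dim [simp]:
  "dim_row (border_block d D) = Suc (dim_row D)" "dim_col (border_block d D) = Suc (dim_col D)"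
  by (auto simp: border_block_def)

lemma border_block_index [simp]:
  "border_block d D $$ (0, 0) = d"
  "j < dim_col D \<Longrightarrow> border_block d D $$ (0, Suc j) = 0"
  "i < dim_row D \<Longrightarrow> border_block d D $$ (Suc i, 0) = 0"
  "i < dim_row D \<Longrightarrow> j < dim_col D \<Longrightarrow> border_block d D $$ (Suc i, Suc j) = D $$ (i, j)"
  by (auto simp: border_block_def)

lemma border_block_mult:
  assumes "A \<in> carrier_mat m n" "B \<in> carrier_mat n k"
  shows "border_block a A * border_block b B = border_block (a * b) (A * B)"
proof (rule eq_matI)
  fix i j assume "i < dim_row (border_block (a * b) (A * B))" "j < dim_col (border_block (a * b) (A * B))"
  then have ij: "i < Suc m" "j < Suc k" using assms by auto
  have *: "(border_block a A * border_block b B) $$ (i, j) =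
      border_block a A $$ (i, 0) * border_block b B $$ (0, j)
      + (\<Sum>l<n. border_block a A $$ (i, Suc l) * border_block b B $$ (Suc l, j))"
    using ij assms
    by (simp add: scalar_prod_def atLeast0LessThan sum.lessThan_Suc_shift del: sum.lessThan_Suc)
  show "(border_block a A * border_block b B) $$ (i, j) = border_block (a * b) (A * B) $$ (i, j)"
    unfolding * using ij assms
    by (cases i; cases j) (auto simp: scalar_prod_def atLeast0LessThan)
qed (use assms in auto)

lemma unimodular_border_block:
  assumes "e * e = 1" "unimodular n P"
  shows "unimodular (Suc n) (border_block e P)"
proof -
  obtain P' where P: "P \<in> carrier_mat n n" "P' \<in> carrier_mat n n" "P * P' = 1\<^sub>m n" "P' * P = 1\<^sub>m n"
    using assms(2) unfolding unimodular_def by blast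
  have "border_block 1 (1\<^sub>m n) = 1\<^sub>m (Suc n)"
    by (rule eq_matI) (auto simp: border_block_def split: nat.split)
  then show ?thesis
    using P assms(1) by (intro unimodularI[of _ _ "border_block e P'"]) (auto simp: border_block_mult[of _ n n _ n])
qed

text \<open>The two blocks can be transformed independently; a unit \<open>e\<close> in the corner of the left factor
makes the pivot nonnegative.\<close>

lemma mat_equiv_border_block:
  assumes "mat_equiv D E"
  shows "mat_equiv (border_block d D) (border_block \<bar>d\<bar> E)"
proof -
  define m where "m = dim_row D"
  define n where "n = dim_col D"
  have D: "D \<in> carrier_mat m n" by (simp add: m_def n_def)
  obtain P Q where PQ: "unimodular m P" "unimodular n Q" "E = P * D * Q"
    using mat_equivE[OF assms D] .
  define e where "e = (if d < 0 then - 1 else 1 :: int)"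
  have e: "e * e = 1" "\<bar>d\<bar> = e * d * 1" by (auto simp: e_def)
  have "P \<in> carrier_mat m m" "Q \<in> carrier_mat n n"
    using PQ unfolding unimodular_def by auto
  then have "border_block \<bar>d\<bar> E = border_block e P * border_block d D * border_block 1 Q"
    using D e(2) PQ(3) by (simp add: border_block_mult[of _ m m _ n] border_block_mult[of _ m n _ n])
  then show ?thesis
    using D unimodular_border_block[OF e(1) PQ(1)] unimodular_border_block[OF _ PQ(2), of 1]
    by (intro mat_equivI[of _ "Suc m" "Suc n" "border_block e P" "border_block 1 Q"]) simp_all
qed

section \<open>Existence of the Smith normal form\<close>

text \<open>Minimality ranges over the whole equivalence class rather than over the entries of one matrix.
This replaces the termination argument of the elimination algorithm: any equivalent matrix that
contained a remainder of a division by \<open>d\<close> would contradict it.\<close>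

definition minimal_pivot :: "int \<Rightarrow> int mat \<Rightarrow> bool" where
  "minimal_pivot d A \<longleftrightarrow> d \<noteq> 0 \<and>
     (\<forall>B i j. mat_equiv A B \<longrightarrow> i < dim_row A \<longrightarrow> j < dim_col A \<longrightarrow> B $$ (i, j) \<noteq> 0 \<longrightarrow>
        \<bar>d\<bar> \<le> \<bar>B $$ (i, j)\<bar>)"

lemma minimal_pivot_exists:
  assumes "A \<in> carrier_mat m n" "i < m" "j < n" "A $$ (i, j) \<noteq> 0"
  obtains B k l where "mat_equiv A B" "k < m" "l < n" "minimal_pivot (B $$ (k, l)) A"
proof -
  define Q where "Q = (\<lambda>(B, k, l). mat_equiv A B \<and> k < m \<and> l < n \<and> B $$ (k, l) \<noteq> (0::int))"
  have "Q (A, i, j)" using assms mat_equiv_refl by (auto simp: Q_def)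
  then obtain x where x: "Q x" "\<And>y. Q y \<Longrightarrow>
      nat \<bar>(\<lambda>(B, k, l). B $$ (k, l)) x\<bar> \<le> nat \<bar>(\<lambda>(B, k, l). B $$ (k, l)) y\<bar>"
    using ex_has_least_nat[of Q "(A, i, j)" "\<lambda>x. nat \<bar>(\<lambda>(B, k, l). B $$ (k, l)) x\<bar>"] by blast
  obtain B k l where xB: "x = (B, k, l)" by (cases x)
  have B: "mat_equiv A B" "k < m" "l < n" "B $$ (k, l) \<noteq> 0"
    using x(1) by (auto simp: xB Q_def)
  have "minimal_pivot (B $$ (k, l)) A"
    unfolding minimal_pivot_def
  proof (intro conjI allI impI)
    fix C i' j' assume C: "mat_equiv A C" "i' < dim_row A" "j' < dim_col A" "C $$ (i', j') \<noteq> 0"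
    have "nat \<bar>B $$ (k, l)\<bar> \<le> nat \<bar>C $$ (i', j')\<bar>"
      using x(2)[of "(C, i', j')"] C assms(1) by (auto simp: Q_def xB)
    then show "\<bar>B $$ (k, l)\<bar> \<le> \<bar>C $$ (i', j')\<bar>" by simp
  qed (use B in auto)
  then show thesis using that B by blast
qed

lemma minimal_pivot_equiv:
  assumes "minimal_pivot d A" "mat_equiv A B"
  shows "minimal_pivot d B"
proof -
  have "B \<in> carrier_mat (dim_row A) (dim_col A)"
    using mat_equiv_carrier[OF assms(2)] by simp
  then show ?thesis
    using assms mat_equiv_trans unfolding minimal_pivot_def by auto
qed

text \<open>One step of division with remainder puts \<open>x mod d\<close> into an equivalent matrix, for any entry \<open>x\<close>
in the line of the pivot; by minimality this remainder is zero.\<close>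

lemma minimal_pivot_dvd_line:
  assumes A: "A \<in> carrier_mat m n" and min: "minimal_pivot (A $$ (i, j)) A"
    and ij: "i < m" "j < n"
  shows "k < m \<Longrightarrow> A $$ (i, j) dvd A $$ (k, j)"
    and "l < n \<Longrightarrow> A $$ (i, j) dvd A $$ (i, l)"
proof -
  let ?d = "A $$ (i, j)"
  have d0: "?d \<noteq> 0" using min by (simp add: minimal_pivot_def)
  have small: "B $$ (k, l) = 0"
    if "mat_equiv A B" "k < m" "l < n" "B $$ (k, l) = x mod ?d" for B k l x
  proof (rule ccontr)
    assume "B $$ (k, l) \<noteq> 0"
    then have "\<bar>?d\<bar> \<le> \<bar>x mod ?d\<bar>"
      using min that A unfolding minimal_pivot_def by (metis carrier_matD)
    moreover have "\<bar>x mod ?d\<bar> < \<bar>?d\<bar>" using d0 by (rule abs_mod_less)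
    ultimately show False by simp
  qed
  show "?d dvd A $$ (k, j)" if k: "k < m"
  proof (cases "k = i")
    case False
    define B where "B = addrow (- (A $$ (k, j) div ?d)) k i A"
    have "B $$ (k, j) = A $$ (k, j) mod ?d"
      using k ij A by (simp add: B_def minus_div_mult_eq_mod [symmetric])
    then show ?thesis
      using small[of B k j] mat_equiv_addrow[OF A k ij(1) False] k ij
      by (auto simp: B_def dvd_eq_mod_eq_0)
  qed simp
  show "?d dvd A $$ (i, l)" if l: "l < n"
  proof (cases "l = j")
    case False
    define B where "B = addcol (- (A $$ (i, l) div ?d)) l j A"
    have "B $$ (i, l) = A $$ (i, l) mod ?d"
      using l ij A by (simp add: B_def minus_div_mult_eq_mod [symmetric])
    then show ?thesis
      using small[of B i l] mat_equiv_addcol[OF A l ij(2) False] l ij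
      by (auto simp: B_def dvd_eq_mod_eq_0)
  qed simp
qed

lemma minimal_pivot_to_corner:
  assumes "B \<in> carrier_mat (Suc m) (Suc n)" "k < Suc m" "l < Suc n"
  obtains C where "mat_equiv B C" "C \<in> carrier_mat (Suc m) (Suc n)" "C $$ (0, 0) = B $$ (k, l)"
proof
  let ?C = "swapcols 0 l (swaprows 0 k B)"
  have r: "swaprows 0 k B \<in> carrier_mat (Suc m) (Suc n)" using assms(1) by simp
  show "mat_equiv B ?C"
    using mat_equiv_swaprows[OF assms(1) _ assms(2), of 0] mat_equiv_swapcols[OF r _ assms(3), of 0]
    by (meson mat_equiv_trans zero_less_Suc)
  show "?C \<in> carrier_mat (Suc m) (Suc n)" "?C $$ (0, 0) = B $$ (k, l)"
    using assms by auto
qed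

lemma clear_first_column:
  assumes A: "A \<in> carrier_mat (Suc m) n" and dvd: "\<And>i. i < m \<Longrightarrow> A $$ (0, 0) dvd A $$ (Suc i, 0)"
    and n: "0 < n"
  obtains B where "mat_equiv A B" "B \<in> carrier_mat (Suc m) n"
    "\<And>j. j < n \<Longrightarrow> B $$ (0, j) = A $$ (0, j)" "\<And>i. i < m \<Longrightarrow> B $$ (Suc i, 0) = 0"
proof -
  have "\<exists>B. mat_equiv A B \<and> B \<in> carrier_mat (Suc m) n \<and> (\<forall>j<n. B $$ (0, j) = A $$ (0, j)) \<and>
      (\<forall>i<m. B $$ (Suc i, 0) = (if i < k then 0 else A $$ (Suc i, 0)))" if "k \<le> m" for k
    using that
  proof (induction k)
    case 0
    then show ?case using A mat_equiv_refl by auto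
  next
    case (Suc k)
    then obtain B where B: "mat_equiv A B" "B \<in> carrier_mat (Suc m) n"
      "\<forall>j<n. B $$ (0, j) = A $$ (0, j)"
      "\<forall>i<m. B $$ (Suc i, 0) = (if i < k then 0 else A $$ (Suc i, 0))"
      by auto
    obtain q where q: "A $$ (Suc k, 0) = A $$ (0, 0) * q"
      using dvd[of k] Suc.prems by auto
    let ?C = "addrow (- q) (Suc k) 0 B"
    have "mat_equiv A ?C"
      using mat_equiv_trans[OF B(1) mat_equiv_addrow[OF B(2)]] Suc.prems by simp
    moreover have "\<forall>j<n. ?C $$ (0, j) = A $$ (0, j)"
      using B(2,3) by auto
    moreover have "\<forall>i<m. ?C $$ (Suc i, 0) = (if i < Suc k then 0 else A $$ (Suc i, 0))"
      using B(2-4) n q by auto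
    ultimately show ?case using B(2) by (intro exI[of _ ?C]) auto
  qed
  from this[of m] show thesis using that by auto
qed

lemma clear_first_row:
  assumes A: "A \<in> carrier_mat m (Suc n)" and dvd: "\<And>j. j < n \<Longrightarrow> A $$ (0, 0) dvd A $$ (0, Suc j)"
    and m: "0 < m"
  obtains B where "mat_equiv A B" "B \<in> carrier_mat m (Suc n)"
    "\<And>i. i < m \<Longrightarrow> B $$ (i, 0) = A $$ (i, 0)" "\<And>j. j < n \<Longrightarrow> B $$ (0, Suc j) = 0"
proof -
  have "\<exists>B. mat_equiv A B \<and> B \<in> carrier_mat m (Suc n) \<and> (\<forall>i<m. B $$ (i, 0) = A $$ (i, 0)) \<and>
      (\<forall>j<n. B $$ (0, Suc j) = (if j < k then 0 else A $$ (0, Suc j)))" if "k \<le> n" for k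
    using that
  proof (induction k)
    case 0
    then show ?case using A mat_equiv_refl by auto
  next
    case (Suc k)
    then obtain B where B: "mat_equiv A B" "B \<in> carrier_mat m (Suc n)"
      "\<forall>i<m. B $$ (i, 0) = A $$ (i, 0)"
      "\<forall>j<n. B $$ (0, Suc j) = (if j < k then 0 else A $$ (0, Suc j))"
      by auto
    obtain q where q: "A $$ (0, Suc k) = A $$ (0, 0) * q"
      using dvd[of k] Suc.prems by auto
    let ?C = "addcol (- q) (Suc k) 0 B"
    have car: "?C \<in> carrier_mat m (Suc n)" by (rule carrier_matI) (use B(2) in simp_all)
    have "mat_equiv A ?C"
      using mat_equiv_trans[OF B(1) mat_equiv_addcol[OF B(2)]] Suc.prems by simp
    moreover have "\<forall>i<m. ?C $$ (i, 0) = A $$ (i, 0)"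
      using B(2,3) by auto
    moreover have "\<forall>j<n. ?C $$ (0, Suc j) = (if j < Suc k then 0 else A $$ (0, Suc j))"
      using B(2-4) m q by auto
    ultimately show ?case using car by (intro exI[of _ ?C]) auto
  qed
  from this[of n] show thesis using that by auto
qed

text \<open>Once the row and the column of a minimal pivot have been cleared, adding any other row to the
first one leaves the pivot in place and brings that row into its line. So the pivot divides the
whole remaining block, which is what makes the diagonal a divisibility chain.\<close>

lemma mat_equiv_split_pivot:
  assumes A: "A \<in> carrier_mat (Suc m) (Suc n)" and ij: "i < Suc m" "j < Suc n" "A $$ (i, j) \<noteq> 0"
  obtains D d where "D \<in> carrier_mat m n" "mat_equiv A (border_block d D)"
    "\<forall>k<m. \<forall>l<n. d dvd D $$ (k, l)"
proof -
  obtain B k l where B: "mat_equiv A B" "k < Suc m" "l < Suc n" "minimal_pivot (B $$ (k, l)) A"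
    using minimal_pivot_exists[OF A ij] .
  define d where "d = B $$ (k, l)"
  have min: "minimal_pivot d C" if "mat_equiv A C" for C
    using minimal_pivot_equiv B(4) that by (simp add: d_def)
  obtain C where C: "mat_equiv B C" "C \<in> carrier_mat (Suc m) (Suc n)" "C $$ (0, 0) = d"
    using minimal_pivot_to_corner[OF mat_equiv_carrier[OF B(1) A] B(2,3)] unfolding d_def .
  have AC: "mat_equiv A C" using B(1) C(1) by (rule mat_equiv_trans)
  note lines = minimal_pivot_dvd_line[of _ "Suc m" "Suc n" 0 0]
  have "C $$ (0, 0) dvd C $$ (Suc i, 0)" if "i < m" for i
    using lines(1)[OF C(2), of "Suc i"] min[OF AC] C(3) that by simp
  then obtain E where E: "mat_equiv C E" "E \<in> carrier_mat (Suc m) (Suc n)"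
    "\<And>j. j < Suc n \<Longrightarrow> E $$ (0, j) = C $$ (0, j)" "\<And>i. i < m \<Longrightarrow> E $$ (Suc i, 0) = 0"
    using clear_first_column[OF C(2)] by auto
  have AE: "mat_equiv A E" using AC E(1) by (rule mat_equiv_trans)
  have E00: "E $$ (0, 0) = d" using C(3) E(3) by simp
  have "E $$ (0, 0) dvd E $$ (0, Suc j)" if "j < n" for j
    using lines(2)[OF E(2), of "Suc j"] min[OF AE] E00 that by simp
  then obtain F where F: "mat_equiv E F" "F \<in> carrier_mat (Suc m) (Suc n)"
    "\<And>i. i < Suc m \<Longrightarrow> F $$ (i, 0) = E $$ (i, 0)" "\<And>j. j < n \<Longrightarrow> F $$ (0, Suc j) = 0"
    using clear_first_row[OF E(2)] by auto
  have AF: "mat_equiv A F" using AE F(1) by (rule mat_equiv_trans)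
  define D where "D = mat m n (\<lambda>(i, j). F $$ (Suc i, Suc j))"
  have D: "D \<in> carrier_mat m n" by (simp add: D_def)
  have "F = border_block d D"
  proof (rule eq_matI)
    fix i j assume "i < dim_row (border_block d D)" "j < dim_col (border_block d D)"
    then show "F $$ (i, j) = border_block d D $$ (i, j)"
      using D E00 E(4) F(3,4) by (cases i; cases j) (auto simp: D_def)
  qed (use D F(2) in auto)
  moreover have "d dvd D $$ (k, l)" if kl: "k < m" "l < n" for k l
  proof -
    \<comment> \<open>The first row of \<open>?G\<close> is the pivot followed by row \<open>k\<close> of \<open>D\<close>.\<close>
    let ?G = "addrow 1 0 (Suc k) F"
    have G: "mat_equiv A ?G"
      using mat_equiv_trans[OF AF mat_equiv_addrow[OF F(2)]] kl by simp
    have "?G $$ (0, 0) = d" "?G $$ (0, Suc l) = D $$ (k, l)"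
      using F(2-4) E(4) E00 kl by (auto simp: D_def)
    then show ?thesis
      using lines(2)[OF mat_equiv_carrier[OF G A], of "Suc l"] min[OF G] kl by simp
  qed
  ultimately show thesis using that[OF D] AF by simp
qed

lemma index_mult_mat_three:
  fixes A :: "'a :: comm_semiring_0 mat"
  assumes "P \<in> carrier_mat k m" "A \<in> carrier_mat m n" "Q \<in> carrier_mat n l" "i < k" "j < l"
  shows "(P * A * Q) $$ (i, j) = (\<Sum>r<m. \<Sum>s<n. P $$ (i, r) * Q $$ (s, j) * A $$ (r, s))"
proof -
  have "(P * A * Q) $$ (i, j) = (\<Sum>s<n. \<Sum>r<m. P $$ (i, r) * A $$ (r, s) * Q $$ (s, j))"
    using assms
    by (simp add: scalar_prod_def atLeast0LessThan sum_distrib_right del: assoc_mult_mat)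
  also have "\<dots> = (\<Sum>r<m. \<Sum>s<n. P $$ (i, r) * A $$ (r, s) * Q $$ (s, j))"
    by (rule sum.swap)
  finally show ?thesis by (simp add: mult.assoc mult.commute[of "A $$ _"])
qed

lemma mat_equiv_dvd_entries:
  assumes A: "A \<in> carrier_mat m n" and eq: "mat_equiv A B"
    and dvd: "\<And>i j. i < m \<Longrightarrow> j < n \<Longrightarrow> (d::int) dvd A $$ (i, j)"
    and ij: "i < m" "j < n"
  shows "d dvd B $$ (i, j)"
proof -
  obtain P Q where PQ: "unimodular m P" "unimodular n Q" "B = P * A * Q"
    using mat_equivE[OF eq A] .
  then have "P \<in> carrier_mat m m" "Q \<in> carrier_mat n n" by (auto simp: unimodular_def)
  then show ?thesis
    using ij dvd A unfolding PQ(3)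
    by (subst index_mult_mat_three[of P m m A n Q n]) (auto intro!: dvd_sum dvd_mult)
qed

text \<open>Induction peels off one pivot at a time. The pivot divides the block that is left, hence also every
matrix equivalent to that block, in particular the entries of its Smith normal form.\<close>

theorem smith_normal_form_exists:
  assumes "A \<in> carrier_mat m n"
  shows "\<exists>S. mat_equiv A S \<and> diagonal_mat S \<and> (\<forall>i < min m n. 0 \<le> S $$ (i, i)) \<and>
    (\<forall>i. Suc i < min m n \<longrightarrow> S $$ (i, i) dvd S $$ (Suc i, Suc i))"
  using assms
proof (induction m arbitrary: n A)
  case 0
  then show ?case using mat_equiv_refl by (intro exI[of _ A]) (auto simp: diagonal_mat_def)
next
  case (Suc m)
  show ?case
  proof (cases "\<exists>i j. i < Suc m \<and> j < n \<and> A $$ (i, j) \<noteq> 0")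
    case False
    then show ?thesis
      using Suc.prems mat_equiv_refl by (intro exI[of _ A]) (auto simp: diagonal_mat_def)
  next
    case True
    then obtain i j k where ij: "i < Suc m" "j < Suc k" "A $$ (i, j) \<noteq> 0" and n: "n = Suc k"
      by (cases n) auto
    obtain D d where D: "D \<in> carrier_mat m k" "mat_equiv A (border_block d D)"
      "\<forall>i<m. \<forall>l<k. d dvd D $$ (i, l)"
      using mat_equiv_split_pivot[OF Suc.prems[unfolded n] ij] .
    obtain S where S: "mat_equiv D S" "diagonal_mat S" "\<forall>i < min m k. 0 \<le> S $$ (i, i)"
      "\<forall>i. Suc i < min m k \<longrightarrow> S $$ (i, i) dvd S $$ (Suc i, Suc i)"
      using Suc.IH[OF D(1)] by blast
    have Sc: "S \<in> carrier_mat m k" using mat_equiv_carrier[OF S(1) D(1)] .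
    let ?S = "border_block \<bar>d\<bar> S"
    have "mat_equiv A ?S"
      using D(2) mat_equiv_border_block[OF S(1)] by (rule mat_equiv_trans)
    moreover have "diagonal_mat ?S"
      unfolding diagonal_mat_def
    proof (intro allI impI)
      fix i j assume "i < dim_row ?S" "j < dim_col ?S" "i \<noteq> j"
      then show "?S $$ (i, j) = 0"
        using S(2) by (cases i; cases j) (auto simp: diagonal_mat_def)
    qed
    moreover have "0 \<le> ?S $$ (i, i)" if "i < min (Suc m) n" for i
      using that S(3) Sc n by (cases i) auto
    moreover have "?S $$ (i, i) dvd ?S $$ (Suc i, Suc i)" if "Suc i < min (Suc m) n" for i
      using that S(4) Sc n mat_equiv_dvd_entries[OF D(1) S(1), of d 0 0] D(3) by (cases i) auto
    ultimately show ?thesis by blast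
  qed
qed

section \<open>Exactly one invariant factor equal to one\<close>

text \<open>Since a Smith normal form exists, the one selected by Hilbert choice is one.\<close>

lemma invariant_factors_mat_spec:
  assumes A: "A \<in> carrier_mat m n"
  obtains S where "mat_equiv A S" "S \<in> carrier_mat m n" "diagonal_mat S"
    "\<forall>i<min m n. 0 \<le> S $$ (i, i)"
    "\<forall>j<min m n. \<forall>i\<le>j. S $$ (i, i) dvd S $$ (j, j)"
    "invariant_factors_mat A = map (\<lambda>i. S $$ (i, i)) [0..<min m n]"
proof -
  define S where "S = smith_normal_form A"
  have spec: "is_smith_normal_form A S \<longleftrightarrow> mat_equiv A S \<and> diagonal_mat S \<and>
      (\<forall>i < min m n. 0 \<le> S $$ (i, i)) \<and>
      (\<forall>i. Suc i < min m n \<longrightarrow> S $$ (i, i) dvd S $$ (Suc i, Suc i))" for S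
    unfolding is_smith_normal_form_def mat_equiv_def unimodular_iff_invertible_mat
      carrier_matD[OF A] conj_assoc by (rule refl)
  have "\<exists>S. is_smith_normal_form A S"
    unfolding spec by (rule smith_normal_form_exists[OF A])
  then have "is_smith_normal_form A S"
    unfolding S_def smith_normal_form_def by (rule someI_ex)
  then have S: "mat_equiv A S" "diagonal_mat S" "\<forall>i<min m n. 0 \<le> S $$ (i, i)"
    "\<And>i. Suc i < min m n \<Longrightarrow> S $$ (i, i) dvd S $$ (Suc i, Suc i)"
    unfolding spec by auto
  have "S $$ (i, i) dvd S $$ (j, j)" if "i \<le> j" "j < min m n" for i j
    using that
  proof (induction j rule: dec_induct)
    case (step j)
    then show ?case using S(4)[of j] by (auto intro: dvd_trans)
  qed simp
  moreover have "invariant_factors_mat A = map (\<lambda>i. S $$ (i, i)) [0..<min m n]"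
    using A unfolding invariant_factors_mat_def S_def by auto
  ultimately show thesis
    using that[OF S(1) mat_equiv_carrier[OF S(1) A] S(2,3)] by simp
qed

text \<open>The case \<open>k = 0\<close> is included and means rank at most one over the integers. For a prime \<open>k\<close>
this is rank at most one over the field with \<open>k\<close> elements.\<close>

definition rank_one_mod :: "int \<Rightarrow> int mat \<Rightarrow> bool" where
  "rank_one_mod k A \<longleftrightarrow>
     (\<exists>a b. \<forall>i < dim_row A. \<forall>j < dim_col A. k dvd A $$ (i, j) - a i * b j)"

lemma rank_one_minor_dvd:
  fixes k :: int
  assumes "[x = a * b] (mod k)" "[y = a' * b'] (mod k)" "[z = a * b'] (mod k)" "[w = a' * b] (mod k)"
  shows "k dvd x * y - z * w"
proof -
  have "[x * y - z * w = a * b * (a' * b') - a * b' * (a' * b)] (mod k)"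
    by (intro cong_diff cong_mult assms)
  then show ?thesis by (simp add: cong_0_iff algebra_simps)
qed

lemma rank_one_mod_dvd_minor:
  assumes "rank_one_mod k A" "i < dim_row A" "i' < dim_row A" "j < dim_col A" "j' < dim_col A"
  shows "k dvd A $$ (i, j) * A $$ (i', j') - A $$ (i, j') * A $$ (i', j)"
proof -
  obtain a b where "[A $$ (i, j) = a i * b j] (mod k)" if "i < dim_row A" "j < dim_col A" for i j
    using assms(1) unfolding rank_one_mod_def cong_iff_dvd_diff by blast
  then show ?thesis
    using assms(2-5) by (intro rank_one_minor_dvd)
qed

text \<open>If \<open>A = a b\<close> modulo \<open>k\<close> for a column \<open>a\<close> and a row \<open>b\<close>, then \<open>P A Q = (P a) (b Q)\<close>. Carrying
the factorisation along instead of the minors avoids the Cauchy-Binet formula.\<close>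

lemma rank_one_mod_equiv:
  assumes rk: "rank_one_mod k A" and eq: "mat_equiv A B"
  shows "rank_one_mod k B"
proof -
  define m where "m = dim_row A"
  define n where "n = dim_col A"
  have A: "A \<in> carrier_mat m n" by (simp add: m_def n_def)
  obtain P Q where PQ: "unimodular m P" "unimodular n Q" "B = P * A * Q"
    using mat_equivE[OF eq A] .
  have c: "P \<in> carrier_mat m m" "Q \<in> carrier_mat n n"
    using PQ by (auto simp: unimodular_def)
  obtain a b where ab: "\<And>i j. i < m \<Longrightarrow> j < n \<Longrightarrow> k dvd A $$ (i, j) - a i * b j"
    using rk unfolding rank_one_mod_def m_def n_def by blast
  let ?a = "\<lambda>i. \<Sum>k<m. P $$ (i, k) * a k" and ?b = "\<lambda>j. \<Sum>l<n. b l * Q $$ (l, j)"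
  have "k dvd B $$ (i, j) - ?a i * ?b j" if ij: "i < m" "j < n" for i j
  proof -
    have "?a i * ?b j = (\<Sum>r<m. \<Sum>s<n. P $$ (i, r) * Q $$ (s, j) * (a r * b s))"
      by (simp add: sum_product algebra_simps)
    then have "B $$ (i, j) - ?a i * ?b j =
        (\<Sum>r<m. \<Sum>s<n. P $$ (i, r) * Q $$ (s, j) * (A $$ (r, s) - a r * b s))"
      unfolding PQ(3) index_mult_mat_three[OF c(1) A c(2) ij]
      by (simp add: right_diff_distrib sum_subtractf)
    also have "k dvd \<dots>"
      using ab by (intro dvd_sum dvd_mult) auto
    finally show ?thesis .
  qed
  moreover have "B \<in> carrier_mat m n" using mat_equiv_carrier[OF eq A] .
  ultimately show ?thesis
    unfolding rank_one_mod_def by (intro exI[of _ ?a] exI[of _ ?b]) auto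
qed

lemma count_list_map_upt_eq_one_iff:
  assumes "\<And>i. 0 < i \<Longrightarrow> i < r \<Longrightarrow> f i = x \<Longrightarrow> f (i - 1) = x"
  shows "count_list (map f [0..<r]) x = 1 \<longleftrightarrow> 0 < r \<and> f 0 = x \<and> (1 < r \<longrightarrow> f 1 \<noteq> x)"
proof -
  have down: "f j = x" if "j \<le> i" "i < r" "f i = x" for i j
    using that
  proof (induction i rule: dec_induct)
    case (step i)
    then show ?case using assms[of "Suc i"] by simp
  qed simp
  show ?thesis
  proof (cases r)
    case (Suc s)
    then have "[0..<r] = 0 # [1..<r]" by (simp add: upt_conv_Cons)
    moreover have "x \<in> f ` {1..<r} \<longleftrightarrow> 1 < r \<and> f 1 = x"
      using down by force
    ultimately show ?thesis
      using down[of 0] Suc count_list_0_iff[of "map f [1..<r]" x] by (auto simp del: upt_Suc)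
  qed simp
qed

text \<open>In determinantal terms the right-hand side says that the gcd of the entries is one and the gcd of
the 2-minors is not. Both conditions can be read off a diagonal matrix. If the diagonal is
\<open>1, f, ...\<close> with \<open>f\<close> dividing all later entries, the matrix agrees modulo \<open>f\<close> with the one whose
only nonzero entry is the leading one. Conversely, the first diagonal entry divides everything,
hence is one, and then the leading 2-minor, a multiple of \<open>k\<close>, is the second diagonal entry.\<close>

theorem exactly_one_unit_invariant_factor_iff:
  assumes A: "A \<in> carrier_mat m n"
  shows "count_list (invariant_factors_mat A) 1 = 1 \<longleftrightarrow>
    (\<forall>d. (\<forall>i<m. \<forall>j<n. d dvd A $$ (i, j)) \<longrightarrow> is_unit d) \<and> (\<exists>k. \<not> is_unit k \<and> rank_one_mod k A)"
    (is "?L \<longleftrightarrow> ?U \<and> ?R")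
proof -
  obtain S where S: "mat_equiv A S" "S \<in> carrier_mat m n" "diagonal_mat S"
    "\<forall>i<min m n. 0 \<le> S $$ (i, i)"
    "\<forall>j<min m n. \<forall>i\<le>j. S $$ (i, i) dvd S $$ (j, j)"
    "invariant_factors_mat A = map (\<lambda>i. S $$ (i, i)) [0..<min m n]"
    using invariant_factors_mat_spec[OF A] .
  have SA: "mat_equiv S A" using S(1) by (rule mat_equiv_sym)
  have unit: "S $$ (i, i) = 1 \<longleftrightarrow> is_unit (S $$ (i, i))" if "i < min m n" for i
    using S(4) that by auto
  have "?L \<longleftrightarrow> 0 < min m n \<and> S $$ (0, 0) = 1 \<and> (1 < min m n \<longrightarrow> S $$ (1, 1) \<noteq> 1)"
    unfolding S(6)
  proof (rule count_list_map_upt_eq_one_iff)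
    fix i assume i: "0 < i" "i < min m n" "S $$ (i, i) = 1"
    then have "i - 1 < min m n" by linarith
    then show "S $$ (i - 1, i - 1) = 1"
      using S(5)[rule_format, of i "i - 1"] unit[of "i - 1"] i by auto
  qed
  also have "\<dots> \<longleftrightarrow> ?U \<and> ?R"
  proof (intro iffI conjI allI impI)
    assume *: "0 < min m n \<and> S $$ (0, 0) = 1 \<and> (1 < min m n \<longrightarrow> S $$ (1, 1) \<noteq> 1)"
    show "is_unit d" if "\<forall>i<m. \<forall>j<n. d dvd A $$ (i, j)" for d
      using mat_equiv_dvd_entries[OF A S(1), of d 0 0] that * by auto
    \<comment> \<open>With a single diagonal entry the matrix has rank one over the integers, so \<open>k = 0\<close> works.\<close>
    define k where "k = (if 1 < min m n then S $$ (1, 1) else 0)"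
    have "\<not> is_unit k"
      using * unit[of 1] by (auto simp: k_def)
    moreover have "rank_one_mod k S"
      unfolding rank_one_mod_def
    proof (intro exI[of _ "\<lambda>i. if i = 0 then 1 else 0"] allI impI)
      fix i j assume ij: "i < dim_row S" "j < dim_col S"
      show "k dvd S $$ (i, j) - (if i = 0 then 1 else 0) * (if j = 0 then 1 else 0)"
      proof (cases "i = j")
        case True
        then show ?thesis
          using ij S(2) S(5)[rule_format, of i 1] * by (cases i) (auto simp: k_def)
      next
        case False
        then show ?thesis using ij S(3) by (auto simp: diagonal_mat_def)
      qed
    qed
    ultimately show ?R using rank_one_mod_equiv[OF _ SA] by blast
  next
    assume *: "?U \<and> ?R"
    have "\<not> is_unit (2 :: int)" by simp
    then show pos: "0 < min m n" using * by fastforce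
    have "S $$ (0, 0) dvd S $$ (i, j)" if "i < m" "j < n" for i j
      using that S(2,3) S(5)[rule_format, of i 0] by (cases "i = j") (auto simp: diagonal_mat_def)
    then have "S $$ (0, 0) dvd A $$ (i, j)" if "i < m" "j < n" for i j
      using mat_equiv_dvd_entries[OF S(2) SA] that by blast
    then show S00: "S $$ (0, 0) = 1"
      using * unit[of 0] pos by blast
    assume r: "1 < min m n"
    obtain k where k: "\<not> is_unit k" "rank_one_mod k S"
      using * rank_one_mod_equiv[OF _ S(1)] by blast
    have "S $$ (0, 1) = 0" using S(2,3) r by (auto simp: diagonal_mat_def)
    then have "k dvd S $$ (1, 1)"
      using rank_one_mod_dvd_minor[OF k(2), of 0 1 0 1] S(2) S00 r by simp
    then show "S $$ (1, 1) \<noteq> 1" using k(1) by auto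
  qed
  finally show ?thesis .
qed

section \<open>Recognising the digraphs \<open>\<Lambda>\<close>\<close>

text \<open>The four kinds of arcs of \<open>\<Lambda>\<close> combine into one rule: every vertex of \<open>T \<union> K\<close> points to every
other vertex of \<open>K \<union> T'\<close>.\<close>

definition Lambda_partition ::
  "('v, 'e) pre_digraph \<Rightarrow> 'v set \<Rightarrow> 'v set \<Rightarrow> 'v set \<Rightarrow> bool" where
  "Lambda_partition G T K T' \<longleftrightarrow>
     verts G = T \<union> K \<union> T' \<and> T \<inter> K = {} \<and> T \<inter> T' = {} \<and> K \<inter> T' = {} \<and>
     (\<forall>u v. u \<rightarrow>\<^bsub>G\<^esub> v \<longleftrightarrow> u \<in> T \<union> K \<and> v \<in> K \<union> T' \<and> u \<noteq> v)"

lemma arcs_Lambda_iff: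
  "(x, y) \<in> arcs (Lambda n1 n2 n3) \<longleftrightarrow>
     x \<in> VT ` {..<n1} \<union> VK ` {..<n2} \<and> y \<in> VK ` {..<n2} \<union> VT' ` {..<n3} \<and> x \<noteq> y"
  by (auto simp: Lambda_def Let_def)

text \<open>The parts are the preimages of the three kinds of vertices. An isomorphism must send an arc to the
pair of the images of its ends, because the arcs of \<open>\<Lambda>\<close> are such pairs, so adjacency can be
read off the vertex map alone.\<close>

lemma (in wf_digraph) Lambda_partition_if_iso:
  assumes "digraph_iso G (Lambda n1 n2 n3)"
  shows "\<exists>T K T'. Lambda_partition G T K T' \<and> card T = n1 \<and> card K = n2 \<and> card T' = n3"
proof -
  obtain f where f: "digraph_isomorphism f" and L: "Lambda n1 n2 n3 = app_iso f G"
    using assms unfolding digraph_iso_def by blast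
  let ?h = "iso_verts f"
  have inj: "inj_on ?h (verts G)"
    using f by (simp add: digraph_isomorphism_def)
  have img: "?h ` verts G = VT ` {..<n1} \<union> VK ` {..<n2} \<union> VT' ` {..<n3}"
    using arg_cong[OF L, of verts] by (auto simp: Lambda_def Let_def)
  have arcs: "arcs (Lambda n1 n2 n3) = iso_arcs f ` arcs G"
    by (simp add: L)
  have ends: "iso_arcs f e = (?h (tail G e), ?h (head G e))" if "e \<in> arcs G" for e
  proof -
    have "iso_tail f = fst" "iso_head f = snd"
      using arg_cong[OF L, of tail] arg_cong[OF L, of head] by (auto simp: Lambda_def Let_def)
    then show ?thesis
      using f that by (simp add: digraph_isomorphism_def prod_eq_iff)
  qed
  have adj: "u \<rightarrow>\<^bsub>G\<^esub> v \<longleftrightarrow> (?h u, ?h v) \<in> arcs (Lambda n1 n2 n3)" if "u \<in> verts G" "v \<in> verts G" for u v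
  proof
    assume "u \<rightarrow>\<^bsub>G\<^esub> v"
    then show "(?h u, ?h v) \<in> arcs (Lambda n1 n2 n3)"
      unfolding arcs using ends by (auto simp: arcs_ends_conv image_iff)
  next
    assume "(?h u, ?h v) \<in> arcs (Lambda n1 n2 n3)"
    then obtain e where "e \<in> arcs G" "?h u = ?h (tail G e)" "?h v = ?h (head G e)"
      unfolding arcs using ends by auto
    then have "e \<in> arcs G" "u = tail G e" "v = head G e"
      using inj that by (auto dest: inj_onD)
    then show "u \<rightarrow>\<^bsub>G\<^esub> v" by (auto simp: arcs_ends_conv)
  qed
  define pre where "pre X = {v \<in> verts G. ?h v \<in> X}" for X
  have card_pre: "card (pre X) = card X" if "X \<subseteq> ?h ` verts G" for X
  proof -
    have "?h ` pre X = X" using that by (auto simp: pre_def)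
    moreover have "inj_on ?h (pre X)" using inj by (rule inj_on_subset) (auto simp: pre_def)
    ultimately show ?thesis using card_image by fastforce
  qed
  let ?T = "pre (VT ` {..<n1})" and ?K = "pre (VK ` {..<n2})" and ?T' = "pre (VT' ` {..<n3})"
  have "Lambda_partition G ?T ?K ?T'"
    unfolding Lambda_partition_def
  proof (intro conjI allI)
    show "verts G = ?T \<union> ?K \<union> ?T'"
      using img by (auto simp: pre_def)
    show "?T \<inter> ?K = {}" "?T \<inter> ?T' = {}" "?K \<inter> ?T' = {}"
      by (auto simp: pre_def)
    fix u v
    show "u \<rightarrow>\<^bsub>G\<^esub> v \<longleftrightarrow> u \<in> ?T \<union> ?K \<and> v \<in> ?K \<union> ?T' \<and> u \<noteq> v"
    proof (cases "u \<in> verts G \<and> v \<in> verts G")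
      case True
      then show ?thesis
        using adj[of u v] inj_on_eq_iff[OF inj, of u v] by (auto simp: pre_def arcs_Lambda_iff)
    next
      case False
      then show ?thesis using adj_in_verts by (auto simp: pre_def)
    qed
  qed
  moreover have "card ?T = n1" "card ?K = n2" "card ?T' = n3"
    using img by (subst card_pre; auto simp: card_image inj_on_def)+
  ultimately show ?thesis by blast
qed

text \<open>Any numbering of the three parts extends to an isomorphism; it is injective on arcs because there
are no multiple arcs.\<close>

lemma (in digraph) iso_if_Lambda_partition:
  assumes "Lambda_partition G T K T'"
  shows "digraph_iso G (Lambda (card T) (card K) (card T'))"
proof -
  note P = assms[unfolded Lambda_partition_def]
  have fin: "finite T" "finite K" "finite T'"
    using P finite_verts by (metis finite_Un)+
  obtain g1 where g1: "bij_betw g1 T {0..<card T}" using ex_bij_betw_finite_nat[OF fin(1)] by blast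
  obtain g2 where g2: "bij_betw g2 K {0..<card K}" using ex_bij_betw_finite_nat[OF fin(2)] by blast
  obtain g3 where g3: "bij_betw g3 T' {0..<card T'}" using ex_bij_betw_finite_nat[OF fin(3)] by blast
  define h where "h v = (if v \<in> T then VT (g1 v) else if v \<in> K then VK (g2 v) else VT' (g3 v))" for v
  have h: "v \<in> T \<Longrightarrow> h v = VT (g1 v)" "v \<in> K \<Longrightarrow> h v = VK (g2 v)" "v \<in> T' \<Longrightarrow> h v = VT' (g3 v)" for v
    using P by (auto simp: h_def)
  have img1: "h ` T = VT ` {..<card T}"
    using g1 h(1) by (auto simp: bij_betw_def atLeast0LessThan image_iff)
  have img2: "h ` K = VK ` {..<card K}"
    using g2 h(2) by (auto simp: bij_betw_def atLeast0LessThan image_iff)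
  have img3: "h ` T' = VT' ` {..<card T'}"
    using g3 h(3) by (auto simp: bij_betw_def atLeast0LessThan image_iff)
  have inj: "inj_on h (verts G)"
  proof (rule inj_onI)
    fix u v assume "u \<in> verts G" "v \<in> verts G" "h u = h v"
    then show "u = v"
      using P g1 g2 g3 unfolding bij_betw_def by (auto simp: h dest: inj_onD)
  qed
  define f where "f = \<lparr>iso_verts = h, iso_arcs = \<lambda>e. (h (tail G e), h (head G e)),
    iso_head = snd, iso_tail = fst\<rparr>"
  have "inj_on (\<lambda>e. (h (tail G e), h (head G e))) (arcs G)"
  proof (rule inj_onI)
    fix d e assume "d \<in> arcs G" "e \<in> arcs G"
      "(h (tail G d), h (head G d)) = (h (tail G e), h (head G e))"
    then show "d = e"
      using inj by (intro no_multi_arcs) (auto simp: arc_to_ends_def dest: inj_onD)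
  qed
  then have "digraph_isomorphism f"
    using inj wf_digraph by (auto simp: digraph_isomorphism_def f_def)
  moreover have "Lambda (card T) (card K) (card T') = app_iso f G"
  proof -
    have "(x, y) \<in> arcs (Lambda (card T) (card K) (card T')) \<longleftrightarrow>
        (x, y) \<in> (\<lambda>(u, v). (h u, h v)) ` arcs_ends G" for x y
    proof
      assume "(x, y) \<in> arcs (Lambda (card T) (card K) (card T'))"
      then have "x \<in> h ` (T \<union> K)" "y \<in> h ` (K \<union> T')" "x \<noteq> y"
        unfolding arcs_Lambda_iff image_Un img1 img2 img3 by auto
      then obtain u v where "x = h u" "y = h v" "u \<in> T \<union> K" "v \<in> K \<union> T'" "u \<noteq> v" by blast
      moreover from this have "u \<rightarrow>\<^bsub>G\<^esub> v" using P by simp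
      ultimately show "(x, y) \<in> (\<lambda>(u, v). (h u, h v)) ` arcs_ends G"
        by (auto intro!: rev_image_eqI)
    next
      assume "(x, y) \<in> (\<lambda>(u, v). (h u, h v)) ` arcs_ends G"
      then obtain u v where uv: "x = h u" "y = h v" "u \<rightarrow>\<^bsub>G\<^esub> v" by auto
      then have "u \<in> T \<union> K" "v \<in> K \<union> T'" "u \<noteq> v" using P by auto
      moreover have "h u \<noteq> h v"
        using uv(3) \<open>u \<noteq> v\<close> inj adj_in_verts by (auto dest: inj_onD)
      ultimately show "(x, y) \<in> arcs (Lambda (card T) (card K) (card T'))"
        unfolding arcs_Lambda_iff uv img1[symmetric] img2[symmetric] img3[symmetric] by auto
    qed
    then have "arcs (Lambda (card T) (card K) (card T')) = (\<lambda>e. (h (tail G e), h (head G e))) ` arcs G"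
      by (auto simp: arcs_ends_conv image_image)
    moreover have "verts (Lambda (card T) (card K) (card T')) = h ` verts G"
      using P by (simp add: Lambda_def Let_def img1 img2 img3 image_Un)
    ultimately show ?thesis
      by (intro pre_digraph.equality) (auto simp: f_def Lambda_def Let_def)
  qed
  ultimately show ?thesis unfolding digraph_iso_def by blast
qed

section \<open>The Laplacian of a simple digraph\<close>

lemma (in nomulti_digraph) arc_multiplicity_eq:
  "arc_multiplicity G u v = (if u \<rightarrow>\<^bsub>G\<^esub> v then 1 else 0)"
proof (cases "u \<rightarrow>\<^bsub>G\<^esub> v")
  case True
  then obtain e where e: "e \<in> arcs G" "tail G e = u" "head G e = v" by blast
  then have "{e \<in> arcs G. tail G e = u \<and> head G e = v} = {e}"
    using no_multi_arcs by (auto simp: arc_to_ends_def)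
  then show ?thesis using True by (simp add: arc_multiplicity_def)
next
  case False
  then have "{e \<in> arcs G. tail G e = u \<and> head G e = v} = {}"
    by (auto simp: arcs_ends_conv)
  then show ?thesis using False unfolding arc_multiplicity_def by (metis card.empty)
qed

lemma (in nomulti_digraph) out_degree_eq_card: "out_degree G u = card {v. u \<rightarrow>\<^bsub>G\<^esub> v}"
proof -
  have "{v. u \<rightarrow>\<^bsub>G\<^esub> v} = head G ` out_arcs G u"
    by (auto simp: arcs_ends_conv)
  moreover have "inj_on (head G) (out_arcs G u)"
    by (rule inj_onI) (auto intro: no_multi_arcs simp: arc_to_ends_def)
  ultimately show ?thesis by (simp add: out_degree_def card_image)
qed

lemma (in nomulti_digraph) laplacian_eq:
  "laplacian G u v =
     (if u = v then int (card {w. u \<rightarrow>\<^bsub>G\<^esub> w}) else if u \<rightarrow>\<^bsub>G\<^esub> v then - 1 else 0)"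
  by (simp add: laplacian_def arc_multiplicity_eq out_degree_eq_card)

text \<open>The criterion for matrices, stated on vertices so that the enumeration of the vertices disappears.\<close>

theorem (in fin_digraph) exactly_one_unit_critical_group_iff:
  "count_list (critical_group_invariant_factors G) 1 = 1 \<longleftrightarrow>
     (\<forall>d. (\<forall>u \<in> verts G. \<forall>v \<in> verts G. d dvd laplacian G u v) \<longrightarrow> is_unit d) \<and>
     (\<exists>k a b. \<not> is_unit k \<and> (\<forall>u \<in> verts G. \<forall>v \<in> verts G. k dvd laplacian G u v - a u * b v))"
proof -
  define n where "n = card (verts G)"
  define vs where "vs = vertex_order G"
  have "distinct vs \<and> set vs = verts G"
    unfolding vs_def vertex_order_def
    by (rule someI_ex) (use finite_distinct_list[OF finite_verts] in blast)
  then have bij: "bij_betw ((!) vs) {..<n} (verts G)"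
    using distinct_card[of vs] by (intro bij_betw_nth) (auto simp: n_def)
  have L: "laplacian_mat G \<in> carrier_mat n n"
    "\<And>i j. i < n \<Longrightarrow> j < n \<Longrightarrow> laplacian_mat G $$ (i, j) = laplacian G (vs ! i) (vs ! j)"
    by (auto simp: laplacian_mat_def n_def vs_def)
  have all: "(\<forall>u \<in> verts G. P u) \<longleftrightarrow> (\<forall>i<n. P (vs ! i))" for P
    using bij_betw_imp_surj_on[OF bij, symmetric] by auto
  have "rank_one_mod k (laplacian_mat G) \<longleftrightarrow>
      (\<exists>a b. \<forall>u \<in> verts G. \<forall>v \<in> verts G. k dvd laplacian G u v - a u * b v)" (is "?l \<longleftrightarrow> ?r") for k
  proof
    assume ?l
    then obtain a b where ab: "\<forall>i<n. \<forall>j<n. k dvd laplacian_mat G $$ (i, j) - a i * b j"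
      using L(1) by (auto simp: rank_one_mod_def)
    let ?pos = "the_inv_into {..<n} ((!) vs)"
    have "?pos (vs ! i) = i" if "i < n" for i
      using bij that by (simp add: bij_betw_def the_inv_into_f_f)
    then show ?r
      using ab unfolding all by (intro exI[of _ "a \<circ> ?pos"] exI[of _ "b \<circ> ?pos"]) (simp add: L(2))
  next
    assume ?r
    then obtain a b where
      "\<forall>u \<in> verts G. \<forall>v \<in> verts G. k dvd laplacian G u v - a u * b v" by blast
    then show ?l
      using L(1) unfolding all rank_one_mod_def
      by (intro exI[of _ "\<lambda>i. a (vs ! i)"] exI[of _ "\<lambda>i. b (vs ! i)"]) (simp add: L(2))
  qed
  then show ?thesis
    unfolding critical_group_invariant_factors_def exactly_one_unit_invariant_factor_iff[OF L(1)]
    by (simp add: all L(2))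
qed

section \<open>Arc structure forced by a single unit invariant factor\<close>

lemma (in fin_digraph) laplacian_minor_not_unit:
  assumes "count_list (critical_group_invariant_factors G) 1 = 1"
    and "u \<in> verts G" "u' \<in> verts G" "v \<in> verts G" "v' \<in> verts G"
  shows "\<not> is_unit (laplacian G u v * laplacian G u' v' - laplacian G u v' * laplacian G u' v)"
proof -
  obtain k a b where k: "\<not> is_unit k"
    and ab: "\<And>u v. u \<in> verts G \<Longrightarrow> v \<in> verts G \<Longrightarrow> [laplacian G u v = a u * b v] (mod k)"
    using assms(1) unfolding exactly_one_unit_critical_group_iff cong_iff_dvd_diff by blast
  then have "k dvd laplacian G u v * laplacian G u' v' - laplacian G u v' * laplacian G u' v"
    using assms(2-5) by (intro rank_one_minor_dvd)
  then show ?thesis using k dvd_trans by blast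
qed

text \<open>If \<open>w\<close> points to \<open>x\<close> but \<open>w'\<close> does not, although \<open>w'\<close> has an out-neighbour \<open>y\<close>, then the rows
\<open>w, w'\<close> and columns \<open>x, y\<close> form the matrix with rows \<open>(-1, *)\<close> and \<open>(0, -1)\<close>, whose determinant
is one. So all non-sinks agree on which other vertices they point to. If \<open>y = w\<close>, the entry
\<open>*\<close> is the out-degree of \<open>w\<close>, which the zero below it cancels.\<close>

lemma (in digraph) same_out_neighbours:
  assumes one: "count_list (critical_group_invariant_factors G) 1 = 1"
    and arcs: "w \<rightarrow>\<^bsub>G\<^esub> x" "w' \<rightarrow>\<^bsub>G\<^esub> y" and neq: "x \<noteq> w'"
  shows "w' \<rightarrow>\<^bsub>G\<^esub> x"
proof (rule ccontr)
  assume no: "\<not> w' \<rightarrow>\<^bsub>G\<^esub> x"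
  have "w \<noteq> x" "w' \<noteq> y" using arcs adj_not_same by auto
  then have "laplacian G w x = - 1" "laplacian G w' y = - 1" "laplacian G w' x = 0"
    using arcs no neq by (auto simp: laplacian_eq)
  moreover have "\<not> is_unit (laplacian G w x * laplacian G w' y - laplacian G w y * laplacian G w' x)"
    by (intro laplacian_minor_not_unit[OF one] adj_in_verts[OF arcs(1)] adj_in_verts[OF arcs(2)])
  ultimately show False by simp
qed

lemma (in wf_digraph) connected_imp_adjacent:
  assumes "connected G" "u \<in> verts G" "v \<in> verts G" "u \<noteq> v"
  obtains w where "v \<rightarrow>\<^bsub>G\<^esub> w \<or> w \<rightarrow>\<^bsub>G\<^esub> v"
proof -
  have "(v, u) \<in> ((arcs_ends G)\<^sup>s)\<^sup>*"
    using assms by (auto simp: connected_conv intro: rtrancl_on_rtranclI)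
  then show thesis
    using assms(4) that by (cases rule: converse_rtranclE) (auto simp: symcl_def)
qed

text \<open>Split the vertices into sources with an out-arc, vertices with arcs in both directions, and sinks.
By \<open>same_out_neighbours\<close> a vertex that receives an arc receives one from every other non-sink, and
connectedness ensures that every sink receives an arc.\<close>

lemma (in digraph) Lambda_partition_if_exactly_one_unit:
  assumes conn: "connected G"
    and one: "count_list (critical_group_invariant_factors G) 1 = 1"
  shows "\<exists>T K T'. Lambda_partition G T K T'"
proof -
  define T where "T = {u \<in> verts G. (\<exists>v. u \<rightarrow>\<^bsub>G\<^esub> v) \<and> (\<nexists>w. w \<rightarrow>\<^bsub>G\<^esub> u)}"
  define K where "K = {u \<in> verts G. (\<exists>v. u \<rightarrow>\<^bsub>G\<^esub> v) \<and> (\<exists>w. w \<rightarrow>\<^bsub>G\<^esub> u)}"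
  define T' where "T' = {u \<in> verts G. \<nexists>v. u \<rightarrow>\<^bsub>G\<^esub> v}"
  have "u \<rightarrow>\<^bsub>G\<^esub> v \<longleftrightarrow> u \<in> T \<union> K \<and> v \<in> K \<union> T' \<and> u \<noteq> v" for u v
  proof
    assume "u \<rightarrow>\<^bsub>G\<^esub> v"
    then show "u \<in> T \<union> K \<and> v \<in> K \<union> T' \<and> u \<noteq> v"
      using adj_in_verts adj_not_same unfolding T_def K_def T'_def by blast
  next
    assume uv: "u \<in> T \<union> K \<and> v \<in> K \<union> T' \<and> u \<noteq> v"
    then obtain y where "u \<rightarrow>\<^bsub>G\<^esub> y" by (auto simp: T_def K_def)
    moreover obtain w where "w \<rightarrow>\<^bsub>G\<^esub> v"
    proof (cases "v \<in> K")
      case True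
      then show ?thesis using that by (auto simp: K_def)
    next
      case False
      then have "v \<in> T'" "u \<in> verts G" using uv by (auto simp: T_def K_def)
      then show ?thesis
        using that uv connected_imp_adjacent[OF conn, of u v] unfolding T'_def by blast
    qed
    ultimately show "u \<rightarrow>\<^bsub>G\<^esub> v" using same_out_neighbours[OF one] uv by blast
  qed
  moreover have "verts G = T \<union> K \<union> T'" "T \<inter> K = {}" "T \<inter> T' = {}" "K \<inter> T' = {}"
    unfolding T_def K_def T'_def by blast+
  ultimately show ?thesis unfolding Lambda_partition_def by blast
qed

section \<open>The Laplacian of \<open>\<Lambda>\<close>\<close>

lemma (in fin_digraph) Lambda_partition_finite:
  assumes "Lambda_partition G T K T'"
  shows "finite T" "finite K" "finite T'"
proof -
  have "finite (T \<union> K \<union> T')"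
    using assms finite_verts by (simp add: Lambda_partition_def)
  then show "finite T" "finite K" "finite T'" by simp_all
qed

text \<open>With \<open>m = |K \<union> T'|\<close>, the row of a non-sink \<open>u\<close> is \<open>m e\<^sub>u\<close> minus the indicator of \<open>K \<union> T'\<close>. For
\<open>u\<close> in \<open>K\<close> the out-degree is only \<open>m - 1\<close>, but the indicator is one at \<open>u\<close>.\<close>

lemma (in digraph) laplacian_Lambda:
  assumes P: "Lambda_partition G T K T'" and u: "u \<in> T \<union> K"
  shows "laplacian G u v =
    (if u = v then int (card (K \<union> T')) else 0) - (if v \<in> K \<union> T' then 1 else 0)"
proof (cases "u = v")
  case True
  have fin: "finite (K \<union> T')" using Lambda_partition_finite[OF P] by simp
  have nbrs: "{w. u \<rightarrow>\<^bsub>G\<^esub> w} = K \<union> T' - {u}"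
    using P u unfolding Lambda_partition_def by blast
  show ?thesis
  proof (cases "u \<in> K \<union> T'")
    case True
    have "int (card (K \<union> T' - {u})) = int (card (K \<union> T')) - 1"
      using card.remove[OF fin True] by linarith
    then show ?thesis
      unfolding laplacian_eq nbrs using True \<open>u = v\<close> by (simp del: card_Diff_insert card_Diff_singleton)
  next
    case False
    then show ?thesis unfolding laplacian_eq nbrs using \<open>u = v\<close> by simp
  qed
next
  case False
  then show ?thesis using P u by (auto simp: laplacian_eq Lambda_partition_def)
qed

text \<open>Let \<open>m = |K \<union> T'|\<close>. Modulo \<open>m\<close> all non-sinks have the same row, so for \<open>m \<noteq> 1\<close> the rank
is at most one modulo \<open>m\<close>, and any arc contributes an entry \<open>-1\<close>. For \<open>m = 1\<close> the rows and columns
of \<open>T\<close> form an identity matrix, which has a unit 2-minor when \<open>|T| \<ge> 2\<close>; with at most one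
vertex in \<open>T\<close> at most one row is nonzero.\<close>

lemma (in digraph) exactly_one_unit_iff_if_Lambda_partition:
  assumes P: "Lambda_partition G T K T'"
  shows "count_list (critical_group_invariant_factors G) 1 = 1 \<longleftrightarrow>
    (\<exists>u v. u \<rightarrow>\<^bsub>G\<^esub> v) \<and> \<not> (2 \<le> card T \<and> card (K \<union> T') = 1)"
proof (intro iffI conjI)
  note parts = P[unfolded Lambda_partition_def]
  note fin = Lambda_partition_finite[OF P]
  assume one: "count_list (critical_group_invariant_factors G) 1 = 1"
  show "\<exists>u v. u \<rightarrow>\<^bsub>G\<^esub> v"
  proof (rule ccontr)
    assume "\<not> ?thesis"
    then have "2 dvd laplacian G u v" for u v by (simp add: laplacian_eq)
    moreover have "\<not> is_unit (2 :: int)" by simp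
    ultimately show False
      using one unfolding exactly_one_unit_critical_group_iff by blast
  qed
  show "\<not> (2 \<le> card T \<and> card (K \<union> T') = 1)"
  proof
    assume *: "2 \<le> card T \<and> card (K \<union> T') = 1"
    then obtain s t where st: "s \<in> T" "t \<in> T" "s \<noteq> t"
      using card_le_Suc0_iff_eq[OF fin(1)] by fastforce
    then have "s \<notin> K \<union> T'" "t \<notin> K \<union> T'" using parts by auto
    then have "laplacian G s s = 1" "laplacian G t t = 1" "laplacian G s t = 0"
      using st * by (auto simp: laplacian_Lambda[OF P])
    moreover have "\<not> is_unit (laplacian G s s * laplacian G t t - laplacian G s t * laplacian G t s)"
      using st parts by (intro laplacian_minor_not_unit[OF one]) auto
    ultimately show False by simp
  qed
next
  note parts = P[unfolded Lambda_partition_def]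
  note fin = Lambda_partition_finite[OF P]
  assume *: "(\<exists>u v. u \<rightarrow>\<^bsub>G\<^esub> v) \<and> \<not> (2 \<le> card T \<and> card (K \<union> T') = 1)"
  then obtain u v where uv: "u \<rightarrow>\<^bsub>G\<^esub> v" by blast
  then have u: "u \<in> T \<union> K" and v: "v \<in> K \<union> T'" and neq: "u \<noteq> v"
    using parts by auto
  have sink: "laplacian G x y = 0" if "\<nexists>z. x \<rightarrow>\<^bsub>G\<^esub> z" for x y
    using that by (cases "x = y") (simp_all add: laplacian_eq)
  have "laplacian G u v = - 1" using uv neq by (simp add: laplacian_eq)
  then have "\<forall>d. (\<forall>u \<in> verts G. \<forall>v \<in> verts G. d dvd laplacian G u v) \<longrightarrow> is_unit d"
    using adj_in_verts[OF uv] by (metis dvd_minus_iff)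
  moreover have "\<exists>k a b. \<not> is_unit k \<and>
      (\<forall>u \<in> verts G. \<forall>v \<in> verts G. k dvd laplacian G u v - a u * b v)"
  proof (cases "card (K \<union> T') = 1")
    case False
    let ?a = "\<lambda>x. if x \<in> T \<union> K then 1 else 0 :: int"
    let ?b = "\<lambda>y. if y \<in> K \<union> T' then - 1 else 0 :: int"
    have "int (card (K \<union> T')) dvd laplacian G x y - ?a x * ?b y" for x y
    proof (cases "x \<in> T \<union> K")
      case True
      then show ?thesis by (simp add: laplacian_Lambda[OF P])
    next
      case False
      then have "\<nexists>z. x \<rightarrow>\<^bsub>G\<^esub> z" using parts by blast
      then show ?thesis using False by (simp add: sink)
    qed
    moreover have "\<not> is_unit (int (card (K \<union> T')))" using False by simp
    ultimately show ?thesis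
      by (intro exI[of _ "int (card (K \<union> T'))"] exI[of _ ?a] exI[of _ ?b] conjI ballI)
  next
    case True
    then obtain x where "K \<union> T' = {x}" by (rule card_1_singletonE)
    then have KT': "K \<union> T' = {v}" using v by simp
    have T: "card T \<le> Suc 0" using * True by simp
    have "x = u" if "x \<rightarrow>\<^bsub>G\<^esub> z" for x z
    proof -
      have "x \<in> T \<union> K" "x \<noteq> v" using that KT' parts by auto
      then have "x \<in> T" "u \<in> T" using u neq KT' by auto
      then show ?thesis using T card_le_Suc0_iff_eq[OF fin(1)] by blast
    qed
    then have "0 dvd laplacian G x y - (if x = u then 1 else 0) * laplacian G u y" for x y
      using sink[of x y] by (cases "x = u") auto
    moreover have "\<not> is_unit (0 :: int)" by simp
    ultimately show ?thesis
      by (intro exI[of _ 0] exI[of _ "\<lambda>x. if x = u then 1 else 0"] exI[of _ "laplacian G u"] conjI ballI)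
  qed
  ultimately show "count_list (critical_group_invariant_factors G) 1 = 1"
    unfolding exactly_one_unit_critical_group_iff by (rule conjI)
qed

text \<open>There are \<open>u\<close> in \<open>T \<union> K\<close> and \<open>v\<close> in \<open>K \<union> T'\<close> that differ unless one of these sets is
empty or both are the same singleton; in the last case there is just one vertex.\<close>

lemma (in fin_digraph) Lambda_partition_has_arc_iff:
  assumes P: "Lambda_partition G T K T'"
  shows "(\<exists>u v. u \<rightarrow>\<^bsub>G\<^esub> v) \<longleftrightarrow>
    1 \<le> card T + card K \<and> 1 \<le> card K + card T' \<and> 2 \<le> card T + card K + card T'"
proof -
  note parts = P[unfolded Lambda_partition_def]
  note fin = Lambda_partition_finite[OF P]
  have card: "card (T \<union> K) = card T + card K" "card (K \<union> T') = card K + card T'"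
    "card (T \<union> K \<union> T') = card T + card K + card T'"
    using parts fin by (auto simp: card_Un_disjoint Int_Un_distrib2)
  have "u \<rightarrow>\<^bsub>G\<^esub> v \<longleftrightarrow> u \<in> T \<union> K \<and> v \<in> K \<union> T' \<and> u \<noteq> v" for u v
    using parts by simp
  then have "(\<exists>u v. u \<rightarrow>\<^bsub>G\<^esub> v) \<longleftrightarrow> (\<exists>u \<in> T \<union> K. \<exists>v \<in> K \<union> T'. u \<noteq> v)"
    by metis
  also have "\<dots> \<longleftrightarrow> T \<union> K \<noteq> {} \<and> K \<union> T' \<noteq> {} \<and>
      \<not> (\<forall>u \<in> T \<union> K \<union> T'. \<forall>v \<in> T \<union> K \<union> T'. u = v)" (is "_ \<longleftrightarrow> ?R")
  proof
    assume ?R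
    then obtain u v x y where "u \<in> T \<union> K" "v \<in> K \<union> T'"
      "x \<in> T \<union> K \<union> T'" "y \<in> T \<union> K \<union> T'" "x \<noteq> y"
      by auto
    then show "\<exists>u \<in> T \<union> K. \<exists>v \<in> K \<union> T'. u \<noteq> v"
      by (metis UnE UnI1 UnI2)
  qed auto
  also have "\<dots> \<longleftrightarrow> 1 \<le> card (T \<union> K) \<and> 1 \<le> card (K \<union> T') \<and> \<not> card (T \<union> K \<union> T') \<le> Suc 0"
    using fin by (auto simp: card_le_Suc0_iff_eq Suc_le_eq card_gt_0_iff)
  finally show ?thesis by (simp add: card not_le Suc_le_eq numeral_2_eq_2)
qed

section \<open>The classification\<close>

theorem corollary4p2:
  fixes D :: "('v, 'e) pre_digraph"
  assumes "digraph D"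
    and "Digraph_Component.connected D"
  shows "count_list (critical_group_invariant_factors D) 1 = 1 \<longleftrightarrow>
    (\<exists>n1 n2 n3 :: nat. digraph_iso D (Lambda n1 n2 n3) \<and>
      (n1 \<ge> 1 \<and> n2 \<ge> 1 \<and> n3 \<ge> 1
       \<or> n1 = 1 \<and> n2 = 1 \<and> n3 = 0
       \<or> n1 = 1 \<and> n3 = 1 \<and> n2 = 0
       \<or> n2 = 1 \<and> n3 = 1 \<and> n1 = 0
       \<or> n1 \<ge> 0 \<and> n2 \<ge> 2 \<and> n3 \<ge> 0
       \<or> n1 = 0 \<and> n2 = 1 \<and> n3 \<ge> 2
       \<or> n1 = 1 \<and> n2 = 0 \<and> n3 \<ge> 2
       \<or> n1 \<ge> 2 \<and> n2 = 0 \<and> n3 \<ge> 2))"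
    (is "?one \<longleftrightarrow> (\<exists>n1 n2 n3. ?iso n1 n2 n3 \<and> ?sizes n1 n2 n3)")
proof -
  interpret digraph D by (rule assms(1))
  \<comment> \<open>The eight cases together say: some arc exists, and the digraph is not an in-star with two
    or more leaves.\<close>
  have sizes: "?sizes n1 n2 n3 \<longleftrightarrow>
      (1 \<le> n1 + n2 \<and> 1 \<le> n2 + n3 \<and> 2 \<le> n1 + n2 + n3) \<and> \<not> (2 \<le> n1 \<and> n2 + n3 = 1)" for n1 n2 n3
    by (cases "n2 = 0"; cases "n2 = 1"; cases "n1 = 0"; cases "n1 = 1"; cases "n3 = 0"; cases "n3 = 1") auto
  have one: "?one \<longleftrightarrow> ?sizes (card T) (card K) (card T')" if P: "Lambda_partition D T K T'" for T K T'
  proof -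
    have "card (K \<union> T') = card K + card T'"
      using P Lambda_partition_finite[OF P] by (simp add: Lambda_partition_def card_Un_disjoint)
    then show ?thesis
      unfolding sizes exactly_one_unit_iff_if_Lambda_partition[OF P]
        Lambda_partition_has_arc_iff[OF P] by (simp only:)
  qed
  show ?thesis
  proof
    assume ?one
    then obtain T K T' where P: "Lambda_partition D T K T'"
      using Lambda_partition_if_exactly_one_unit[OF assms(2)] by blast
    have "?iso (card T) (card K) (card T')" using P by (rule iso_if_Lambda_partition)
    moreover have "?sizes (card T) (card K) (card T')" using one[OF P] \<open>?one\<close> by (rule iffD1)
    ultimately show "\<exists>n1 n2 n3. ?iso n1 n2 n3 \<and> ?sizes n1 n2 n3" by (intro exI conjI)
  next
    assume "\<exists>n1 n2 n3. ?iso n1 n2 n3 \<and> ?sizes n1 n2 n3"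
    then obtain n1 n2 n3 where iso: "?iso n1 n2 n3" and s: "?sizes n1 n2 n3" by (elim exE conjE)
    obtain T K T' where P: "Lambda_partition D T K T'" and n: "card T = n1" "card K = n2" "card T' = n3"
      using Lambda_partition_if_iso[OF iso] by blast
    show ?one using s unfolding one[OF P] n .
  qed
qed

end
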